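(* Assume the regularity, growth, convexity and constraint-smoothness assumptions on $f$ and $g$ and the standing non-triviality assumptions listed in the context. The boundary subset $[\partial\mathcal A]_0=\partial\mathcal A\cap G_0$ is contained in the set of points $z\in G_0$ such that $$\min_{u\in U_1}\max_{i\in\mathbb I(z)}L_fg_i(z,u)\le0.$$
   Context: Let $n,m,p\ge 1$, $U_1=\{v\in\mathbb R^m:\|v\|\le 1\}$ (Euclidean norm), and let $\mathcal U$ be the set of Lebesgue measurable functions from $[0,\infty)$ to $U_1$. For $u\in\mathcal U$ and $x_0\in\mathbb R^n$, $x^{(u,x_0)}$ denotes the solution of $\dot x(t)=f(x(t),u(t))$, $x(0)=x_0$. The constraint function is $g=(g_1,\dots,g_p):\mathbb R^n\to\mathbb R^p$. Assumptions. (A1) $f(\cdot,u)$ is an at least $C^2$ vector field on $\mathbb R^n$ for every $u$ in an open subset of $\mathbb R^m$ containing $U_1$, and its dependence on $u$ is also at least $C^2$. (A2) There is a constant $0<C<\infty$ such that either $\sup_{u\in U_1}\|f(x,u)\|\le C(1+\|x\|)$ for all $x$, or $\sup_{u\in U_1}|x^Tf(x,u)|\le C(1+\|x\|^2)$ for all $x$. (A3) The set $f(x,U_1)$ is convex for all $x\in\mathbb R^n$. (A4) $g$ is at least $C^2$, and for each $i$ the set $\{x: g_i(x)=0\}$ is an $(n-1)$-dimensional manifold. Notation. $G=\{x: g_i(x)\le 0,\ i=1,\dots,p\}$ (assumed to have nonempty interior); $G_0=\{x\in G: g_i(x)=0\text{ for at least one }i\}$; $\mathbb I(x)=\{i: g_i(x)=0\}$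 for $x\in G_0$. The admissible set is $\mathcal A=\{\bar x\in G:\exists u\in\mathcal U,\ g_i(x^{(u,\bar x)}(t))\le 0\ \forall i,\ \forall t\ge0\}$, with complement $\mathcal A^{\mathsf C}=G\setminus\mathcal A$. The boundary $\partial\mathcal A$ is relative to the topology of $G$. $L_fh(x,u)=Dh(x)f(x,u)$ is the Lie derivative of $h$ along $f(\cdot,u)$. Standing assumptions: $\mathcal A\ne\emptyset$ and $\mathcal A^{\mathsf C}\neq\emptyset$. *)

theory Defs
  imports "HOL-Analysis.Analysis"
begin

text \<open>Twice continuously differentiable on an open set; the second derivative is the
  derivative of the Frechet derivative, viewed as a map into the bounded linear functions.\<close>

definition C2_on :: "'a::real_normed_vector set \<Rightarrow> ('a \<Rightarrow> 'b::real_normed_vector) \<Rightarrow> bool" where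
  "C2_on S h \<longleftrightarrow> open S \<and>
     (\<exists>(h' :: 'a \<Rightarrow> ('a \<Rightarrow>\<^sub>L 'b)) (h'' :: 'a \<Rightarrow> ('a \<Rightarrow>\<^sub>L ('a \<Rightarrow>\<^sub>L 'b))).
        (\<forall>x\<in>S. (h has_derivative blinfun_apply (h' x)) (at x)) \<and>
        (\<forall>x\<in>S. (h' has_derivative blinfun_apply (h'' x)) (at x)) \<and>
        continuous_on S h'')"

text \<open>A subset that is, in the subspace topology, locally homeomorphic to open subsets of
  $k$-dimensional Euclidean space. No smoothness of an embedding is required, and the empty
  set is a manifold of every dimension.\<close>

definition is_manifold :: "nat \<Rightarrow> 'a::euclidean_space set \<Rightarrow> bool" where
  "is_manifold k S \<longleftrightarrow>
     (\<forall>x\<in>S. \<exists>W V. openin (top_of_set S) W \<and> x \<in> W \<and> openin (Euclidean_space k) V \<and>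
        top_of_set W homeomorphic_space subtopology (Euclidean_space k) V)"

text \<open>Absolute continuity on a compact interval; a pair in \<open>D\<close> holds the endpoints of an
  interval.\<close>

definition abs_cont_on :: "real set \<Rightarrow> (real \<Rightarrow> 'a::real_normed_vector) \<Rightarrow> bool" where
  "abs_cont_on S x \<longleftrightarrow>
     (\<forall>e>0. \<exists>d>0. \<forall>D :: (real \<times> real) set.
        finite D \<longrightarrow>
        (\<forall>(a, b)\<in>D. a \<le> b \<and> {a..b} \<subseteq> S) \<longrightarrow>
        disjoint_family_on (\<lambda>(a, b). {a<..<b}) D \<longrightarrow>
        (\<Sum>(a, b)\<in>D. b - a) < d \<longrightarrow>
        (\<Sum>(a, b)\<in>D. norm (x b - x a)) < e)"

text \<open>The control set and the admissible controls. Functions of time are total on the reals,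
  but only their values on $[0,\infty)$ matter.\<close>

abbreviation U1 :: "'u::real_normed_vector set" where
  "U1 \<equiv> cball 0 1"

definition controls :: "(real \<Rightarrow> 'u::euclidean_space) set" where
  "controls = {u. u \<in> borel_measurable (lebesgue_on {0..}) \<and> (\<forall>t\<ge>0. u t \<in> U1)}"

text \<open>Solutions for a merely measurable control are meant in the sense of Caratheodory.\<close>

definition is_solution ::
  "('x::euclidean_space \<Rightarrow> 'u \<Rightarrow> 'x) \<Rightarrow> (real \<Rightarrow> 'u) \<Rightarrow> 'x \<Rightarrow> (real \<Rightarrow> 'x) \<Rightarrow> bool" where
  "is_solution f u x0 x \<longleftrightarrow>
     x 0 = x0 \<and>
     (\<forall>T\<ge>0. abs_cont_on {0..T} x) \<and>
     (AE t in lebesgue_on {0..}. (x has_vector_derivative f (x t) (u t)) (at t within {0..}))"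

definition constraint_set :: "('x \<Rightarrow> real ^ 'p) \<Rightarrow> 'x set" where
  "constraint_set g = {x. \<forall>i. g x $ i \<le> 0}"

definition constraint_set0 :: "('x \<Rightarrow> real ^ 'p) \<Rightarrow> 'x set" where
  "constraint_set0 g = {x \<in> constraint_set g. \<exists>i. g x $ i = 0}"

definition active :: "('x \<Rightarrow> real ^ 'p) \<Rightarrow> 'x \<Rightarrow> 'p set" where
  "active g x = {i. g x $ i = 0}"

text \<open>Under the regularity and growth assumptions on \<open>f\<close> the solution exists on $[0,\infty)$
  and is unique there, so the quantifier over \<open>x\<close> only names it.\<close>

definition admissible ::
  "('x::euclidean_space \<Rightarrow> 'u::euclidean_space \<Rightarrow> 'x) \<Rightarrow> ('x \<Rightarrow> real ^ 'p) \<Rightarrow> 'x set" where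
  "admissible f g =
     {x0 \<in> constraint_set g.
        \<exists>u\<in>controls. \<exists>x. is_solution f u x0 x \<and> (\<forall>i. \<forall>t\<ge>0. g (x t) $ i \<le> 0)}"

definition lie_deriv ::
  "('x::real_normed_vector \<Rightarrow> 'u \<Rightarrow> 'x) \<Rightarrow> ('x \<Rightarrow> real) \<Rightarrow> 'x \<Rightarrow> 'u \<Rightarrow> real" where
  "lie_deriv f h x u = frechet_derivative h (at x) (f x u)"

end

theory Submission
  imports Defs
begin

text \<open>
  A boundary point \<open>z\<close> is a limit of admissible points, and the inequality follows from this together
  with the fact that some constraint is active at \<open>z\<close>. It suffices to find a single control value
  \<open>u\<close> such that the velocity \<open>f z u\<close> does not increase any active constraint to first order; the
  minimum over the compact control set is then attained and at most zero.

  Suppose that there is no such \<open>u\<close>. Then the set \<open>Dg(z) f(z, U1)\<close>, which is compact, and convex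
  because the velocity set is, misses the closed convex cone of vectors whose active components are
  all nonpositive. A separating hyperplane
  (\<open>nonneg_functional_positive_on_compact\<close>) gives weights \<open>a \<ge> 0\<close>, supported on the active indices,
  such that the scalar function \<open>h = a \<bullet> g\<close> has \<open>h z = 0\<close> and a derivative at \<open>z\<close> that is at least some
  \<open>b > 0\<close> on every velocity \<open>f z u\<close>. One weighted constraint thus increases at a definite rate
  whichever control is used.

  By continuity all velocities near \<open>z\<close> have positive component, bounded below, along the gradient
  of \<open>h\<close>, and bounded norm. Hence every trajectory that starts close to \<open>z\<close> stays near \<open>z\<close> for a time
  \<open>T\<close> independent of the starting point and of the control, and during this time gains an amount of
  \<open>h\<close> proportional to \<open>T\<close>. If the starting point is close enough, this outweighs the initial
  deficit, and \<open>h\<close> becomes positive (\<open>solutions_escape\<close>). Along a trajectory that satisfies all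
  constraints, however, \<open>h = a \<bullet> g \<le> 0\<close>, so no point close to \<open>z\<close> is admissible, a contradiction.

  Controls are merely measurable, so a solution has the prescribed velocity only outside a null set.
  What converts velocity bounds into bounds on increments is a mean value inequality for absolutely
  continuous functions (\<open>abs_cont_increment_le\<close>).
\<close>

section \<open>A mean value inequality for absolutely continuous functions\<close>

lemma abs_cont_on_subset:
  assumes "abs_cont_on S x" "T \<subseteq> S"
  shows "abs_cont_on T x"
  unfolding abs_cont_on_def
proof (intro allI impI)
  fix e :: real assume "e > 0"
  then obtain d where "d > 0" and d: "\<forall>D :: (real \<times> real) set. finite D \<longrightarrow>
        (\<forall>(a, b)\<in>D. a \<le> b \<and> {a..b} \<subseteq> S) \<longrightarrow> disjoint_family_on (\<lambda>(a, b). {a<..<b}) D \<longrightarrow>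
        (\<Sum>(a, b)\<in>D. b - a) < d \<longrightarrow> (\<Sum>(a, b)\<in>D. norm (x b - x a)) < e"
    using assms(1) unfolding abs_cont_on_def by meson
  show "\<exists>d>0. \<forall>D :: (real \<times> real) set. finite D \<longrightarrow>
        (\<forall>(a, b)\<in>D. a \<le> b \<and> {a..b} \<subseteq> T) \<longrightarrow> disjoint_family_on (\<lambda>(a, b). {a<..<b}) D \<longrightarrow>
        (\<Sum>(a, b)\<in>D. b - a) < d \<longrightarrow> (\<Sum>(a, b)\<in>D. norm (x b - x a)) < e"
    using \<open>d > 0\<close> d assms(2) by (intro exI[of _ d]) fast
qed

lemma abs_cont_on_inner:
  fixes x :: "real \<Rightarrow> 'a::real_inner"
  assumes "abs_cont_on S x"
  shows "abs_cont_on S (\<lambda>t. l \<bullet> x t)"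
  unfolding abs_cont_on_def
proof (intro allI impI)
  fix e :: real assume "e > 0"
  then have "e / (norm l + 1) > 0"
    by (smt (verit) divide_pos_pos norm_ge_zero)
  then obtain d where "d > 0" and d: "\<And>D :: (real \<times> real) set. finite D \<Longrightarrow>
        (\<forall>(a, b)\<in>D. a \<le> b \<and> {a..b} \<subseteq> S) \<Longrightarrow> disjoint_family_on (\<lambda>(a, b). {a<..<b}) D \<Longrightarrow>
        (\<Sum>(a, b)\<in>D. b - a) < d \<Longrightarrow> (\<Sum>(a, b)\<in>D. norm (x b - x a)) < e / (norm l + 1)"
    using assms unfolding abs_cont_on_def by meson
  have "(\<Sum>(a, b)\<in>D. norm (l \<bullet> x b - l \<bullet> x a)) < e"
    if D: "finite D" "\<forall>(a, b)\<in>D. a \<le> b \<and> {a..b} \<subseteq> S"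
      "disjoint_family_on (\<lambda>(a, b). {a<..<b}) D" "(\<Sum>(a, b)\<in>D. b - a) < d" for D
  proof -
    have "(\<Sum>(a, b)\<in>D. norm (l \<bullet> x b - l \<bullet> x a))
        \<le> (\<Sum>(a, b)\<in>D. (norm l + 1) * norm (x b - x a))"
    proof (rule sum_mono, clarify)
      fix a b
      have "norm (l \<bullet> x b - l \<bullet> x a) \<le> norm l * norm (x b - x a)"
        by (metis Cauchy_Schwarz_ineq2 inner_diff_right real_norm_def)
      also have "\<dots> \<le> (norm l + 1) * norm (x b - x a)"
        by (simp add: mult_right_mono)
      finally show "norm (l \<bullet> x b - l \<bullet> x a) \<le> (norm l + 1) * norm (x b - x a)" .
    qed
    also have "\<dots> = (norm l + 1) * (\<Sum>(a, b)\<in>D. norm (x b - x a))"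
      by (simp add: sum_distrib_left case_prod_unfold)
    also have "\<dots> < (norm l + 1) * (e / (norm l + 1))"
      using d[OF D] by (intro mult_strict_left_mono) (auto intro: add_nonneg_pos)
    also have "\<dots> = e"
      by (smt (verit) nonzero_mult_div_cancel_left norm_ge_zero times_divide_eq_right)
    finally show ?thesis .
  qed
  with \<open>d > 0\<close> show "\<exists>d>0. \<forall>D :: (real \<times> real) set. finite D \<longrightarrow>
        (\<forall>(a, b)\<in>D. a \<le> b \<and> {a..b} \<subseteq> S) \<longrightarrow> disjoint_family_on (\<lambda>(a, b). {a<..<b}) D \<longrightarrow>
        (\<Sum>(a, b)\<in>D. b - a) < d \<longrightarrow> (\<Sum>(a, b)\<in>D. norm (l \<bullet> x b - l \<bullet> x a)) < e"
    by blast
qed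

lemma abs_cont_on_imp_continuous_on:
  assumes "abs_cont_on {a..b} x"
  shows "continuous_on {a..b} x"
  unfolding continuous_on_iff
proof (intro ballI allI impI)
  fix s and e :: real assume s: "s \<in> {a..b}" and "e > 0"
  then obtain d where "d > 0" and d: "\<And>D :: (real \<times> real) set. finite D \<Longrightarrow>
        (\<forall>(u, v)\<in>D. u \<le> v \<and> {u..v} \<subseteq> {a..b}) \<Longrightarrow> disjoint_family_on (\<lambda>(u, v). {u<..<v}) D \<Longrightarrow>
        (\<Sum>(u, v)\<in>D. v - u) < d \<Longrightarrow> (\<Sum>(u, v)\<in>D. norm (x v - x u)) < e"
    using assms unfolding abs_cont_on_def by meson
  have "dist (x t) (x s) < e" if t: "t \<in> {a..b}" "dist t s < d" for t
  proof -
    have "norm (x (max s t) - x (min s t)) < e"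
      using d[of "{(min s t, max s t)}"] s t
      by (auto simp: disjoint_family_on_def dist_real_def min_def max_def)
    then show ?thesis
      by (auto simp: dist_norm min_def max_def norm_minus_commute split: if_splits)
  qed
  with \<open>d > 0\<close> show "\<exists>d>0. \<forall>t\<in>{a..b}. dist t s < d \<longrightarrow> dist (x t) (x s) < e"
    by blast
qed

text \<open>The contribution of the exceptional null set is controlled by enclosing it in an open set of
  small measure: intervals inside that set then have small total length.\<close>

lemma sum_lengths_le_measure:
  fixes D :: "(real \<times> real) set"
  assumes D: "finite D" "\<And>a b. (a, b) \<in> D \<Longrightarrow> a \<le> b \<and> {a<..<b} \<subseteq> U"
    "disjoint_family_on (\<lambda>(a, b). {a<..<b}) D"
    and U: "U \<in> lmeasurable"
  shows "(\<Sum>(a, b)\<in>D. b - a) \<le> measure lebesgue U"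
proof -
  have "(\<Sum>(a, b)\<in>D. b - a) = (\<Sum>I\<in>D. measure lebesgue (case I of (a, b) \<Rightarrow> {a<..<b}))"
    using D(2) by (intro sum.cong) auto
  also have "\<dots> = measure lebesgue (\<Union>I\<in>D. case I of (a, b) \<Rightarrow> {a<..<b})"
    using D by (intro measure_finite_Union[symmetric]) (auto split: prod.splits)
  also have "\<dots> \<le> measure lebesgue U"
    using D U by (intro measure_mono_fmeasurable sets.finite_UN) (auto split: prod.splits)
  finally show ?thesis .
qed

text \<open>By Cousin's lemma the interval has a tagged division finer than any given gauge. A subinterval
  whose tag is a point of differentiability has increment at most \<open>c + e\<close> times its length. The
  subintervals tagged in the null set lie in an open set of small measure, so by absolute continuity
  their increments add up to less than \<open>e\<close>.\<close>

lemma abs_cont_increment_le: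
  fixes \<phi> :: "real \<Rightarrow> real"
  assumes ac: "abs_cont_on {a..b} \<phi>" and "a \<le> b" and N: "negligible N"
    and deriv: "\<And>t. t \<in> {a..b} - N \<Longrightarrow>
      \<exists>v. (\<phi> has_vector_derivative v) (at t within {a..b}) \<and> v \<le> c"
  shows "\<phi> b - \<phi> a \<le> c * (b - a)"
proof -
  have approx: "\<phi> b - \<phi> a \<le> c * (b - a) + e * (b - a + 2)" if "e > 0" for e
  proof -
    obtain d0 where "d0 > 0" and d0: "\<And>D :: (real \<times> real) set. finite D \<Longrightarrow>
        (\<forall>(u, v)\<in>D. u \<le> v \<and> {u..v} \<subseteq> {a..b}) \<Longrightarrow> disjoint_family_on (\<lambda>(u, v). {u<..<v}) D \<Longrightarrow>
        (\<Sum>(u, v)\<in>D. v - u) < d0 \<Longrightarrow> (\<Sum>(u, v)\<in>D. norm (\<phi> v - \<phi> u)) < e"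
      using ac \<open>e > 0\<close> unfolding abs_cont_on_def by meson
    \<comment> \<open>Besides the oscillation of \<open>\<phi>\<close> over the bad subintervals, their share of \<open>(c + e) * (b - a)\<close>
      has to be small, hence the second bound.\<close>
    define d where "d = min d0 (e / (\<bar>c\<bar> + e + 1))"
    have "\<bar>c\<bar> + e + 1 > 0"
      using \<open>e > 0\<close> by linarith
    then have "d > 0" "d \<le> d0" and d_le: "(\<bar>c\<bar> + e) * d \<le> e"
    proof -
      show "d > 0" "d \<le> d0"
        using \<open>\<bar>c\<bar> + e + 1 > 0\<close> \<open>d0 > 0\<close> \<open>e > 0\<close> by (auto simp: d_def)
      have "(\<bar>c\<bar> + e) * d \<le> (\<bar>c\<bar> + e + 1) * d"
        using \<open>d > 0\<close> by (simp add: algebra_simps)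
      also have "\<dots> \<le> (\<bar>c\<bar> + e + 1) * (e / (\<bar>c\<bar> + e + 1))"
        using \<open>\<bar>c\<bar> + e + 1 > 0\<close> by (intro mult_left_mono) (auto simp: d_def)
      finally show "(\<bar>c\<bar> + e) * d \<le> e"
        using \<open>\<bar>c\<bar> + e + 1 > 0\<close> by simp
    qed
    obtain U where U: "open U" "N \<subseteq> U" "U \<in> lmeasurable" "measure lebesgue U < d"
    proof -
      have null: "N \<in> null_sets lebesgue"
        using N negligible_iff_null_sets by blast
      then have "N \<in> sets lebesgue"
        by blast
      then obtain U where U: "open U" "N \<subseteq> U" "(U - N) \<in> lmeasurable"
        "emeasure lebesgue (U - N) < ennreal d"
        using sets_lebesgue_outer_open[of N d] \<open>d > 0\<close> by blast
      have "U \<in> sets lebesgue"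
        using U(1) by (simp add: borel_open)
      then have "emeasure lebesgue U = emeasure lebesgue (U - N)"
        using null by (simp add: emeasure_Diff_null_set)
      with U(4) have less: "emeasure lebesgue U < ennreal d"
        by simp
      then have "U \<in> lmeasurable"
        using \<open>U \<in> sets lebesgue\<close> by (auto simp: fmeasurable_def intro: less_trans)
      with less have "measure lebesgue U < d"
        using \<open>d > 0\<close> by (simp add: emeasure_eq_measure2 ennreal_less_iff)
      with U \<open>U \<in> lmeasurable\<close> that show thesis
        by blast
    qed
    have "\<exists>r>0. (t \<in> N \<longrightarrow> ball t r \<subseteq> U) \<and>
        (t \<in> {a..b} - N \<longrightarrow> (\<forall>u v. u \<in> {a..b} \<and> v \<in> {a..b} \<and> u \<le> t \<and> t \<le> v \<and> {u..v} \<subseteq> ball t r \<longrightarrow>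
           \<phi> v - \<phi> u \<le> (c + e) * (v - u)))" for t
    proof (cases "t \<in> N")
      case True
      then show ?thesis
        using U by (meson DiffD2 open_contains_ball subsetD)
    next
      case False
      show ?thesis
      proof (cases "t \<in> {a..b}")
        case True
        with False obtain w where w: "(\<phi> has_vector_derivative w) (at t within {a..b})" "w \<le> c"
          using deriv by blast
        then obtain r where "r > 0" and r: "\<And>y. y \<in> {a..b} \<Longrightarrow> norm (y - t) < r \<Longrightarrow>
            norm (\<phi> y - \<phi> t - (y - t) *\<^sub>R w) \<le> e * norm (y - t)"
          using \<open>e > 0\<close> unfolding has_vector_derivative_def has_derivative_within_alt by meson
        have "\<phi> v - \<phi> u \<le> (c + e) * (v - u)"
          if uv: "u \<in> {a..b}" "v \<in> {a..b}" "u \<le> t" "t \<le> v" "{u..v} \<subseteq> ball t r" for u v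
        proof -
          have "u \<in> {u..v}" "v \<in> {u..v}"
            using uv by auto
          then have "u \<in> ball t r" "v \<in> ball t r"
            using uv(5) by blast+
          then have "\<phi> v - \<phi> t - (v - t) * w \<le> e * (v - t)" "\<phi> t - \<phi> u - (t - u) * w \<le> e * (t - u)"
            using r[of v] r[of u] uv by (auto simp: dist_real_def algebra_simps)
          then have "\<phi> v - \<phi> u \<le> (w + e) * (v - u)"
            by (simp add: algebra_simps)
          also have "\<dots> \<le> (c + e) * (v - u)"
            using uv w(2) by (intro mult_right_mono) auto
          finally show ?thesis .
        qed
        with \<open>r > 0\<close> False show ?thesis
          by blast
      qed (use False in \<open>auto intro: exI[of _ 1]\<close>)
    qed
    then obtain r where r: "\<And>t. r t > 0" "\<And>t. t \<in> N \<Longrightarrow> ball t (r t) \<subseteq> U"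
      "\<And>t u v. t \<in> {a..b} - N \<Longrightarrow> u \<in> {a..b} \<Longrightarrow> v \<in> {a..b} \<Longrightarrow> u \<le> t \<Longrightarrow> t \<le> v \<Longrightarrow>
         {u..v} \<subseteq> ball t (r t) \<Longrightarrow> \<phi> v - \<phi> u \<le> (c + e) * (v - u)"
      by metis
    have "gauge (\<lambda>t. ball t (r t))"
      using r(1) by (simp add: gauge_ball_dependent)
    then obtain p where p: "p tagged_division_of {a..b}" and fine: "(\<lambda>t. ball t (r t)) fine p"
      using fine_division_exists_real by blast
    note pD = tagged_division_ofD[OF p]
    have K: "K = {Inf K..Sup K} \<and> Inf K \<le> t \<and> t \<le> Sup K \<and> Inf K \<in> {a..b} \<and> Sup K \<in> {a..b}
        \<and> {Inf K..Sup K} \<subseteq> ball t (r t)" if tK: "(t, K) \<in> p" for t K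
    proof -
      obtain u v where uv: "K = {u..v}"
        using pD(4)[OF tK] by auto
      moreover have "t \<in> K" "K \<subseteq> {a..b}" "K \<subseteq> ball t (r t)"
        using pD(2,3)[OF tK] fineD[OF fine tK] by auto
      ultimately show ?thesis
        by auto
    qed
    \<comment> \<open>\<open>w\<close> is the slack of a subinterval in the estimate with slope \<open>c + e\<close>; it is nonnegative when
      the tag lies outside \<open>N\<close>. The pairs in \<open>D\<close> are the endpoints of the subintervals tagged in \<open>N\<close>.\<close>
    define w where "w = (\<lambda>(t::real, K). (c + e) * (Sup K - Inf K) - (\<phi> (Sup K) - \<phi> (Inf K)))"
    define q where "q = {I \<in> p. fst I \<in> N}"
    define D where "D = (\<lambda>(t::real, K). (Inf K, Sup K)) ` q"
    have "finite q" "finite D"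
      using pD(1) by (auto simp: q_def D_def)
    have interior_K: "interior K = {Inf K<..<Sup K}" if "(t, K) \<in> p" for t K
      using K[OF that] interior_atLeastAtMost_real by metis
    \<comment> \<open>A degenerate subinterval determines its tag; a nondegenerate one can occur only once since
      distinct members have disjoint interiors.\<close>
    have inj: "inj_on (\<lambda>(t, K). (Inf K, Sup K)) p"
    proof (rule inj_onI, clarify)
      fix t1 K1 t2 K2 assume p1: "(t1, K1) \<in> p" and p2: "(t2, K2) \<in> p"
        and eq: "Inf K1 = Inf K2" "Sup K1 = Sup K2"
      have "K1 = K2"
        using K[OF p1] K[OF p2] eq by metis
      moreover have "t1 = t2"
      proof (rule ccontr)
        assume "t1 \<noteq> t2"
        then have "interior K1 = {}"
          using pD(5)[OF p1 p2] \<open>K1 = K2\<close> by auto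
        then show False
          using interior_K[OF p1] K[OF p1] K[OF p2] eq \<open>t1 \<noteq> t2\<close> by auto
      qed
      ultimately show "t1 = t2 \<and> K1 = K2" by simp
    qed
    have reindex: "(\<Sum>(u, v)\<in>D. h u v) = (\<Sum>(t, K)\<in>q. h (Inf K) (Sup K))"
      for h :: "real \<Rightarrow> real \<Rightarrow> real"
      unfolding D_def using inj_on_subset[OF inj, of q]
      by (subst sum.reindex) (auto simp: q_def case_prod_unfold)
    have D_in: "\<exists>t K. (t, K) \<in> q \<and> u = Inf K \<and> v = Sup K" if "(u, v) \<in> D" for u v
      using that by (auto simp: D_def)
    have disj: "disjoint_family_on (\<lambda>(u, v). {u<..<v}) D"
      unfolding disjoint_family_on_def
    proof (intro ballI impI)
      fix I J assume "I \<in> D" "J \<in> D" "I \<noteq> J"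
      then obtain u1 v1 u2 v2 where D1: "(u1, v1) \<in> D" and D2: "(u2, v2) \<in> D"
        and ne: "\<not> (u1 = u2 \<and> v1 = v2)" and IJ: "I = (u1, v1)" "J = (u2, v2)"
        by (cases I; cases J) auto
      obtain t1 K1 where K1: "(t1, K1) \<in> p" "u1 = Inf K1" "v1 = Sup K1"
        using D_in[OF D1] by (auto simp: q_def)
      obtain t2 K2 where K2: "(t2, K2) \<in> p" "u2 = Inf K2" "v2 = Sup K2"
        using D_in[OF D2] by (auto simp: q_def)
      have "interior K1 \<inter> interior K2 = {}"
        using pD(5)[OF K1(1) K2(1)] K1 K2 ne by auto
      then have "{u1<..<v1} \<inter> {u2<..<v2} = {}"
        using K1 K2 interior_K by metis
      then show "(case I of (u, v) \<Rightarrow> {u<..<v}) \<inter> (case J of (u, v) \<Rightarrow> {u<..<v}) = {}"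
        by (simp add: IJ)
    qed
    have D_sub: "u \<le> v \<and> {u..v} \<subseteq> {a..b} \<and> {u<..<v} \<subseteq> U" if "(u, v) \<in> D" for u v
    proof -
      obtain t K where tK: "(t, K) \<in> p" "t \<in> N" "u = Inf K" "v = Sup K"
        using D_in[OF \<open>(u, v) \<in> D\<close>] by (auto simp: q_def)
      have "{u..v} \<subseteq> U"
        using K[OF tK(1)] r(2)[OF tK(2)] tK by blast
      moreover have "{u..v} \<subseteq> {a..b}"
        using K[OF tK(1)] pD(3)[OF tK(1)] tK by metis
      ultimately show ?thesis
        using K[OF tK(1)] tK greaterThanLessThan_subseteq_atLeastAtMost_iff[of u v u v] by auto
    qed
    have len: "(\<Sum>(u, v)\<in>D. v - u) < d"
      using sum_lengths_le_measure[OF \<open>finite D\<close> _ disj U(3)] D_sub U(4) by fastforce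
    then have osc: "(\<Sum>(u, v)\<in>D. norm (\<phi> v - \<phi> u)) < e"
      using d0[OF \<open>finite D\<close> _ disj] D_sub \<open>d \<le> d0\<close> by fastforce
    have "- (2 * e) \<le> (\<Sum>(u, v)\<in>D. - (\<bar>c\<bar> + e) * (v - u) - norm (\<phi> v - \<phi> u))"
    proof -
      have "(\<bar>c\<bar> + e) * (\<Sum>(u, v)\<in>D. v - u) \<le> (\<bar>c\<bar> + e) * d"
        using len \<open>e > 0\<close> by (intro mult_left_mono) auto
      moreover have "(\<Sum>(u, v)\<in>D. - (\<bar>c\<bar> + e) * (v - u) - norm (\<phi> v - \<phi> u))
          = - (\<bar>c\<bar> + e) * (\<Sum>(u, v)\<in>D. v - u) - (\<Sum>(u, v)\<in>D. norm (\<phi> v - \<phi> u))"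
        unfolding sum_distrib_left case_prod_unfold by (rule sum_subtractf)
      ultimately show ?thesis
        using osc d_le by (simp add: algebra_simps)
    qed
    also have "\<dots> = (\<Sum>(t, K)\<in>q. - (\<bar>c\<bar> + e) * (Sup K - Inf K) - norm (\<phi> (Sup K) - \<phi> (Inf K)))"
      by (rule reindex)
    also have "\<dots> \<le> (\<Sum>I\<in>q. w I)"
    proof (rule sum_mono, clarify)
      fix t K assume "(t, K) \<in> q"
      then have "Inf K \<le> Sup K"
        using K[of t K] by (auto simp: q_def)
      then have "- (\<bar>c\<bar> + e) * (Sup K - Inf K) \<le> (c + e) * (Sup K - Inf K)"
        using \<open>e > 0\<close> by (intro mult_right_mono) auto
      then show "- (\<bar>c\<bar> + e) * (Sup K - Inf K) - norm (\<phi> (Sup K) - \<phi> (Inf K)) \<le> w (t, K)"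
        by (auto simp: w_def)
    qed
    also have "\<dots> \<le> (\<Sum>I\<in>p. w I)"
    proof (rule sum_mono2[OF pD(1)])
      show "q \<subseteq> p"
        by (auto simp: q_def)
      fix I assume "I \<in> p - q"
      then obtain t K where I: "I = (t, K)" "(t, K) \<in> p" "t \<notin> N"
        by (cases I) (auto simp: q_def)
      then have "\<phi> (Sup K) - \<phi> (Inf K) \<le> (c + e) * (Sup K - Inf K)"
        using K[OF I(2)] by (intro r(3)[of t]) auto
      then show "0 \<le> w I"
        by (simp add: I w_def)
    qed
    also have "\<dots> = (c + e) * (\<Sum>(t, K)\<in>p. Sup K - Inf K) - (\<Sum>(t, K)\<in>p. \<phi> (Sup K) - \<phi> (Inf K))"
      unfolding w_def sum_distrib_left case_prod_unfold by (rule sum_subtractf)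
    also have "\<dots> = (c + e) * (b - a) - (\<phi> b - \<phi> a)"
      using additive_tagged_division_1[OF \<open>a \<le> b\<close> p, of \<phi>]
        additive_tagged_division_1[OF \<open>a \<le> b\<close> p, of "\<lambda>x. x"] by simp
    finally show ?thesis
      by (simp add: algebra_simps)
  qed
  show ?thesis
  proof (rule field_le_epsilon)
    fix e :: real assume "e > 0"
    then show "\<phi> b - \<phi> a \<le> c * (b - a) + e"
      using approx[of "e / (b - a + 2)"] \<open>a \<le> b\<close> by simp
  qed
qed

lemma abs_cont_inner_increment_le:
  fixes x :: "real \<Rightarrow> 'a::real_inner"
  assumes "abs_cont_on {a..b} x" "a \<le> b" "negligible N"
    and deriv: "\<And>t. t \<in> {a..b} - N \<Longrightarrow>
      \<exists>v. (x has_vector_derivative v) (at t within {a..b}) \<and> l \<bullet> v \<le> c"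
  shows "l \<bullet> (x b - x a) \<le> c * (b - a)"
proof -
  have "l \<bullet> x b - l \<bullet> x a \<le> c * (b - a)"
  proof (rule abs_cont_increment_le[OF abs_cont_on_inner[OF assms(1)] assms(2,3)])
    fix t assume "t \<in> {a..b} - N"
    then obtain v where "(x has_vector_derivative v) (at t within {a..b})" "l \<bullet> v \<le> c"
      using deriv by blast
    then show "\<exists>v. ((\<lambda>t. l \<bullet> x t) has_vector_derivative v) (at t within {a..b}) \<and> v \<le> c"
      using bounded_linear.has_vector_derivative[OF bounded_linear_inner_right] by blast
  qed
  then show ?thesis
    by (simp add: inner_diff_right)
qed

text \<open>Apply the bound on the component in the direction of the increment itself.\<close>

lemma abs_cont_increment_norm_le:
  fixes x :: "real \<Rightarrow> 'a::real_inner"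
  assumes "abs_cont_on {a..b} x" "a \<le> b" "negligible N" "M \<ge> 0"
    and deriv: "\<And>t. t \<in> {a..b} - N \<Longrightarrow>
      \<exists>v. (x has_vector_derivative v) (at t within {a..b}) \<and> norm v \<le> M"
  shows "norm (x b - x a) \<le> M * (b - a)"
proof -
  let ?l = "x b - x a"
  have "?l \<bullet> (x b - x a) \<le> (norm ?l * M) * (b - a)"
  proof (rule abs_cont_inner_increment_le[OF assms(1-3)])
    fix t assume "t \<in> {a..b} - N"
    then obtain v where v: "(x has_vector_derivative v) (at t within {a..b})" "norm v \<le> M"
      using deriv by blast
    then have "?l \<bullet> v \<le> norm ?l * M"
      by (meson mult_left_mono norm_cauchy_schwarz norm_ge_zero order_trans)
    with v show "\<exists>v. (x has_vector_derivative v) (at t within {a..b}) \<and> ?l \<bullet> v \<le> norm ?l * M"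
      by blast
  qed
  then have "norm ?l * norm ?l \<le> norm ?l * (M * (b - a))"
    by (simp add: dot_square_norm power2_eq_square mult.assoc)
  then show ?thesis
    using \<open>M \<ge> 0\<close> \<open>a \<le> b\<close> by (cases "norm ?l = 0") (auto simp: mult_le_cancel_left)
qed

section \<open>Short-time behaviour of solutions\<close>

text \<open>The speed bound is available only while the curve is inside the ball, so it is used up to the
  first exit time, where it shows that the boundary could not have been reached.\<close>

lemma abs_cont_stays_in_ball:
  fixes x :: "real \<Rightarrow> 'a::real_inner"
  assumes ac: "abs_cont_on {0..T} x" and N: "negligible N" and "M \<ge> 0"
    and deriv: "\<And>t. t \<in> {0..T} - N \<Longrightarrow>
      \<exists>v. (x has_vector_derivative v) (at t within {0..T}) \<and> (x t \<in> ball z r \<longrightarrow> norm v \<le> M)"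
    and small: "dist z (x 0) + M * T < r" and t: "t \<in> {0..T}"
  shows "x t \<in> ball z r"
proof (rule ccontr)
  assume out: "x t \<notin> ball z r"
  define S where "S = {s \<in> {0..T}. r \<le> dist z (x s)}"
  have "closed S"
    unfolding S_def using abs_cont_on_imp_continuous_on[OF ac]
    by (intro continuous_on_closed_Collect_le continuous_intros) auto
  moreover have "S \<noteq> {}" "bdd_below S"
    using t out by (auto simp: S_def)
  ultimately have s: "Inf S \<in> S"
    by (simp add: closed_contains_Inf)
  define s where "s = Inf S"
  have s_in: "s \<in> {0..T}" "r \<le> dist z (x s)"
    using s by (auto simp: s_def S_def)
  have before: "x w \<in> ball z r" if "w \<in> {0..s}" "w \<noteq> s" for w
  proof -
    have "w \<notin> S"
      using cInf_lower[of w S] \<open>bdd_below S\<close> that by (auto simp: s_def)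
    then show ?thesis
      using that s_in by (auto simp: S_def)
  qed
  have "norm (x s - x 0) \<le> M * (s - 0)"
  proof (rule abs_cont_increment_norm_le)
    show "abs_cont_on {0..s} x"
      using ac s_in by (auto intro: abs_cont_on_subset)
    \<comment> \<open>At the exit time itself the curve is outside the ball, so that instant joins the null set.\<close>
    show "negligible (insert s N)"
      using N by simp
    fix w assume w: "w \<in> {0..s} - insert s N"
    then obtain v where "(x has_vector_derivative v) (at w within {0..T})"
        "x w \<in> ball z r \<longrightarrow> norm v \<le> M"
      using deriv[of w] s_in by auto
    then show "\<exists>v. (x has_vector_derivative v) (at w within {0..s}) \<and> norm v \<le> M"
      using before[of w] w s_in has_vector_derivative_within_subset[of x v w "{0..T}" "{0..s}"]
      by auto
  qed (use s_in \<open>M \<ge> 0\<close> in auto)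
  also have "\<dots> \<le> M * T"
    using s_in \<open>M \<ge> 0\<close> by (simp add: mult_left_mono)
  finally have "dist (x s) (x 0) \<le> M * T"
    by (simp add: dist_norm)
  then show False
    using dist_triangle[of z "x s" "x 0"] small s_in(2) by (simp add: dist_commute)
qed

lemma solution_derivative:
  assumes "is_solution f u x0 x" "u \<in> controls"
  obtains N where "negligible N"
    "\<And>t. t \<ge> 0 \<Longrightarrow> t \<notin> N \<Longrightarrow> (x has_vector_derivative f (x t) (u t)) (at t within {0..})"
proof -
  have "AE t in lebesgue. t \<in> {0..} \<longrightarrow> (x has_vector_derivative f (x t) (u t)) (at t within {0..})"
    using assms(1) unfolding is_solution_def by (subst (asm) AE_restrict_space_iff) auto
  then obtain N where "N \<in> null_sets lebesgue"
    "{t. \<not> (t \<in> {0..} \<longrightarrow> (x has_vector_derivative f (x t) (u t)) (at t within {0..}))} \<subseteq> N"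
    by (auto simp: eventually_ae_filter)
  then show thesis
    using that negligible_iff_null_sets by blast
qed

lemma velocity_bounds_near:
  fixes f :: "'x::euclidean_space \<Rightarrow> 'u::euclidean_space \<Rightarrow> 'x"
  assumes cont: "continuous_on (UNIV \<times> U1) (\<lambda>(y, u). f y u)"
    and low: "\<And>u. u \<in> U1 \<Longrightarrow> b \<le> l \<bullet> f z u" and "b > 0"
  obtains r M where "r > 0" "M > 0"
    "\<And>y u. y \<in> ball z r \<Longrightarrow> u \<in> U1 \<Longrightarrow> b / 2 \<le> l \<bullet> f y u \<and> norm (f y u) \<le> M"
proof -
  let ?X = "cball z 1 \<times> (U1 :: 'u set)"
  have X: "compact ?X"
    by (intro compact_Times compact_cball)
  have cX: "continuous_on ?X (\<lambda>(y, u). f y u)"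
    using cont by (rule continuous_on_subset) auto
  then have "bounded ((\<lambda>(y, u). f y u) ` ?X)"
    using X compact_continuous_image compact_imp_bounded by blast
  then obtain M where "M > 0" and M: "\<And>y u. y \<in> cball z 1 \<Longrightarrow> u \<in> U1 \<Longrightarrow> norm (f y u) \<le> M"
    unfolding bounded_pos by fastforce
  have "continuous_on ?X (\<lambda>p. l \<bullet> (case p of (y, u) \<Rightarrow> f y u))"
    by (intro continuous_intros cX)
  then have "uniformly_continuous_on ?X (\<lambda>p. l \<bullet> (case p of (y, u) \<Rightarrow> f y u))"
    using X compact_uniformly_continuous by blast
  moreover have "b / 2 > 0"
    using \<open>b > 0\<close> by simp
  ultimately obtain d where "d > 0" and d: "\<And>p q. p \<in> ?X \<Longrightarrow> q \<in> ?X \<Longrightarrow> dist q p < d \<Longrightarrow>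
      dist (l \<bullet> (case q of (y, u) \<Rightarrow> f y u)) (l \<bullet> (case p of (y, u) \<Rightarrow> f y u)) < b / 2"
    unfolding uniformly_continuous_on_def by meson
  show thesis
  proof
    show "min 1 d > 0" "M > 0"
      using \<open>d > 0\<close> \<open>M > 0\<close> by auto
    fix y and u :: 'u assume y: "y \<in> ball z (min 1 d)" and u: "u \<in> U1"
    have "dist (l \<bullet> f y u) (l \<bullet> f z u) < b / 2"
      using d[of "(z, u)" "(y, u)"] y u by (auto simp: dist_Pair_Pair dist_commute)
    then have "b / 2 \<le> l \<bullet> f y u"
      using low[OF u] unfolding dist_real_def by linarith
    then show "b / 2 \<le> l \<bullet> f y u \<and> norm (f y u) \<le> M"
      using M[of y u] y u by auto
  qed
qed

text \<open>If \<open>h\<close> increases at \<open>z\<close> along every available velocity, then solutions from all points near \<open>z\<close>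
  make \<open>h\<close> positive, including those that start where \<open>h\<close> is negative. Along the
  solution it is the linearization \<open>l\<close> of \<open>h\<close> at \<open>z\<close> that is followed; near \<open>z\<close> it differs from \<open>h\<close> by a
  small multiple of the distance from \<open>z\<close>.\<close>

lemma solutions_escape:
  fixes f :: "'x::euclidean_space \<Rightarrow> 'u::euclidean_space \<Rightarrow> 'x"
  assumes cont: "continuous_on (UNIV \<times> U1) (\<lambda>(y, u). f y u)"
    and h: "(h has_derivative (\<lambda>v. l \<bullet> v)) (at z)" "h z = 0"
    and low: "\<And>u. u \<in> U1 \<Longrightarrow> b \<le> l \<bullet> f z u" and "b > 0"
  obtains e where "e > 0"
    "\<And>x0 u x. dist x0 z < e \<Longrightarrow> u \<in> controls \<Longrightarrow> is_solution f u x0 x \<Longrightarrow> \<exists>t\<ge>0. h (x t) > 0"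
proof -
  obtain r M where "r > 0" "M > 0" and bounds:
    "\<And>y u. y \<in> ball z r \<Longrightarrow> u \<in> U1 \<Longrightarrow> b / 2 \<le> l \<bullet> f y u \<and> norm (f y u) \<le> M"
    using velocity_bounds_near[OF cont low \<open>b > 0\<close>] by blast
  \<comment> \<open>At speed at most \<open>M\<close> the solution gains at least \<open>b T / 2\<close> in direction \<open>l\<close>. The choice of \<open>\<eta>\<close>
    limits the linearization error of the displacement to \<open>b T / 8\<close>, and that of \<open>e\<close> limits the
    effect of starting away from \<open>z\<close> to another \<open>b T / 8\<close>. Since \<open>M T = R / 2\<close>, the solution stays
    within \<open>R\<close> of \<open>z\<close> up to time \<open>T\<close>.\<close>
  define \<eta> where "\<eta> = b / (8 * M)"
  have "\<eta> > 0"
    using \<open>b > 0\<close> \<open>M > 0\<close> by (simp add: \<eta>_def)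
  then obtain d where "d > 0" and d: "\<And>y. norm (y - z) < d \<Longrightarrow> norm (h y - h z - l \<bullet> (y - z)) \<le> \<eta> * norm (y - z)"
    using h(1) unfolding has_derivative_within_alt by (metis UNIV_I)
  define R where "R = min r d"
  define T where "T = R / (2 * M)"
  define e where "e = min (R / 2) (b * T / (8 * (norm l + \<eta>)))"
  have "R > 0" "T > 0" "norm l + \<eta> > 0"
    using \<open>r > 0\<close> \<open>d > 0\<close> \<open>M > 0\<close> \<open>\<eta> > 0\<close> by (auto simp: R_def T_def add_nonneg_pos)
  then have "e > 0"
    using \<open>b > 0\<close> by (auto simp: e_def)
  have "\<exists>t\<ge>0. h (x t) > 0"
    if x0: "dist x0 z < e" and u: "u \<in> controls" and sol: "is_solution f u x0 x" for x0 u x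
  proof -
    have ac: "abs_cont_on {0..T} x" and "x 0 = x0"
      using sol \<open>T > 0\<close> by (auto simp: is_solution_def)
    obtain N where N: "negligible N" and
      "\<And>t. t \<ge> 0 \<Longrightarrow> t \<notin> N \<Longrightarrow> (x has_vector_derivative f (x t) (u t)) (at t within {0..})"
      using solution_derivative[OF sol u] by blast
    then have deriv: "(x has_vector_derivative f (x t) (u t)) (at t within {0..T})"
      if "t \<in> {0..T} - N" for t
      using that by (meson DiffE atLeastAtMost_iff atLeast_iff has_vector_derivative_within_subset subsetI)
    have U: "u t \<in> U1" if "t \<in> {0..T}" for t
      using u that by (auto simp: controls_def)
    have "M * T = R / 2"
      using \<open>M > 0\<close> by (simp add: T_def)
    then have small: "dist z (x 0) + M * T < R"
      using x0 \<open>x 0 = x0\<close> by (auto simp: e_def dist_commute)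
    have inball: "x t \<in> ball z R" if "t \<in> {0..T}" for t
    proof (rule abs_cont_stays_in_ball[OF ac N _ _ small that])
      fix s assume s: "s \<in> {0..T} - N"
      show "\<exists>v. (x has_vector_derivative v) (at s within {0..T}) \<and> (x s \<in> ball z R \<longrightarrow> norm v \<le> M)"
        using deriv[OF s] U[of s] bounds[of "x s" "u s"] s by (auto simp: R_def)
    qed (use \<open>M > 0\<close> in auto)
    have bd: "b / 2 \<le> l \<bullet> f (x t) (u t) \<and> norm (f (x t) (u t)) \<le> M" if "t \<in> {0..T}" for t
      using bounds[of "x t" "u t"] inball[OF that] U[OF that] by (auto simp: R_def)
    have "norm (x T - x 0) \<le> M * (T - 0)"
      using deriv bd \<open>T > 0\<close> \<open>M > 0\<close>
      by (intro abs_cont_increment_norm_le[OF ac _ N]) auto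
    then have dist_T: "norm (x T - x0) \<le> M * T"
      using \<open>x 0 = x0\<close> by simp
    have "(- l) \<bullet> (x T - x 0) \<le> - (b / 2) * (T - 0)"
      using deriv bd \<open>T > 0\<close>
      by (intro abs_cont_inner_increment_le[OF ac _ N]) (auto simp: inner_minus_left)
    then have gain: "b * T / 2 \<le> l \<bullet> (x T - x0)"
      using \<open>x 0 = x0\<close> by (simp add: inner_minus_left)
    have "norm (x0 - z) < e"
      using x0 by (simp add: dist_norm)
    have start: "- (norm l * norm (x0 - z)) \<le> l \<bullet> (x0 - z)"
      using Cauchy_Schwarz_ineq2[of l "x0 - z"] by linarith
    have "norm (x T - z) < d"
      using inball[of T] \<open>T > 0\<close> by (auto simp: R_def dist_norm norm_minus_commute)
    then have "l \<bullet> (x T - z) - \<eta> * norm (x T - z) \<le> h (x T)"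
      using d[of "x T"] h(2) by auto
    moreover have "norm (x T - z) \<le> M * T + norm (x0 - z)"
      using norm_triangle_ineq[of "x T - x0" "x0 - z"] dist_T by simp
    then have "\<eta> * norm (x T - z) \<le> \<eta> * (M * T + norm (x0 - z))"
      using \<open>\<eta> > 0\<close> by (simp add: mult_left_mono)
    moreover have "l \<bullet> (x T - z) = l \<bullet> (x T - x0) + l \<bullet> (x0 - z)"
      by (simp add: inner_diff_right)
    moreover have "\<eta> * (M * T + norm (x0 - z)) = b * T / 8 + \<eta> * norm (x0 - z)"
      using \<open>M > 0\<close> by (simp add: \<eta>_def field_simps)
    moreover have "norm l * norm (x0 - z) + \<eta> * norm (x0 - z) \<le> b * T / 8"
    proof -
      have "norm (x0 - z) \<le> b * T / (8 * (norm l + \<eta>))"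
        using \<open>norm (x0 - z) < e\<close> by (simp add: e_def)
      moreover have "8 * (norm l + \<eta>) > 0"
        using \<open>norm l + \<eta> > 0\<close> by simp
      ultimately have "norm (x0 - z) * (8 * (norm l + \<eta>)) \<le> b * T"
        using pos_le_divide_eq by blast
      then show ?thesis
        by (simp add: algebra_simps)
    qed
    moreover have "b * T > 0"
      using \<open>b > 0\<close> \<open>T > 0\<close> by simp
    ultimately have "h (x T) > 0"
      using gain start by linarith
    then show ?thesis
      using \<open>T > 0\<close> by (intro exI[of _ T]) auto
  qed
  with \<open>e > 0\<close> show thesis
    using that by blast
qed

section \<open>Separation from the cone of non-increasing directions\<close>

text \<open>A hyperplane separating \<open>S\<close> from the cone of vectors with nonpositive components in \<open>I\<close>: since
  the functional \<open>a\<close> is bounded above on a cone, it is nonpositive there, which fixes the signs of its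
  coefficients, and makes the coefficients outside \<open>I\<close>, where the cone contains both directions,
  vanish.\<close>

lemma nonneg_functional_positive_on_compact:
  fixes S :: "(real ^ 'p) set"
  assumes "convex S" "compact S" "S \<noteq> {}"
    and no: "\<And>s. s \<in> S \<Longrightarrow> \<exists>i\<in>I. s $ i > 0"
  obtains a b where "b > 0" "\<And>s. s \<in> S \<Longrightarrow> b \<le> a \<bullet> s" "\<And>i. a $ i \<ge> 0" "\<And>i. i \<notin> I \<Longrightarrow> a $ i = 0"
proof -
  define K :: "(real ^ 'p) set" where "K = (\<Inter>i\<in>I. {w. w $ i \<le> 0})"
  have "convex K"
    unfolding K_def by (intro convex_INT convexI) (auto simp: add_nonpos_nonpos mult_nonneg_nonpos)
  moreover have "closed K"
    unfolding K_def by (intro closed_INT ballI closed_Collect_le continuous_intros)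
  moreover have "K \<inter> S = {}"
    using no by (fastforce simp: K_def)
  ultimately obtain a b where K: "\<And>w. w \<in> K \<Longrightarrow> a \<bullet> w < b" and S: "\<And>s. s \<in> S \<Longrightarrow> b < a \<bullet> s"
    using separating_hyperplane_closed_compact[of K S] assms by meson
  have "b > 0"
    using K[of 0] by (simp add: K_def)
  \<comment> \<open>\<open>k\<close> is the sign of an axis direction that belongs to the cone; \<open>-1\<close> is possible for every
    index, \<open>1\<close> only outside \<open>I\<close>.\<close>
  have a_sign: "k * a $ i \<le> 0" if "\<And>c. c \<ge> 0 \<Longrightarrow> axis i (c * k) \<in> K" for i k
  proof (rule ccontr)
    assume "\<not> k * a $ i \<le> 0"
    then have pos: "k * a $ i > 0"
      by simp
    have "a \<bullet> axis i (b / (k * a $ i) * k) < b"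
      using pos \<open>b > 0\<close> by (intro K that) (simp add: less_imp_le)
    moreover have "k \<noteq> 0" "a $ i \<noteq> 0"
      using pos by auto
    ultimately show False
      by (simp add: inner_axis)
  qed
  have "a $ i \<ge> 0" for i
    using a_sign[of i "-1"] by (auto simp: K_def axis_def)
  moreover have "a $ i = 0" if "i \<notin> I" for i
    using a_sign[of i 1] that \<open>\<And>i. a $ i \<ge> 0\<close>[of i] by (force simp: K_def axis_def)
  ultimately show thesis
    using that[of b a] \<open>b > 0\<close> S by (meson less_imp_le)
qed

lemma continuous_on_MAX:
  fixes F :: "'i \<Rightarrow> 'a::topological_space \<Rightarrow> real"
  assumes "finite I" "I \<noteq> {}" "\<And>i. i \<in> I \<Longrightarrow> continuous_on S (F i)"
  shows "continuous_on S (\<lambda>u. MAX i\<in>I. F i u)"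
  using assms
proof (induction rule: finite_ne_induct)
  case (insert i I)
  then have "(\<lambda>u. MAX j\<in>insert i I. F j u) = (\<lambda>u. max (F i u) (MAX j\<in>I. F j u))"
    by (intro ext) simp
  then show ?case
    using insert by (auto intro!: continuous_on_max)
qed auto

section \<open>The condition on the active constraints\<close>

theorem proposition5p3:
  fixes f :: "real ^ 'n \<Rightarrow> real ^ 'm \<Rightarrow> real ^ 'n"
    and g :: "real ^ 'n \<Rightarrow> real ^ 'p"
  assumes A1: "\<exists>\<Omega>. open \<Omega> \<and> U1 \<subseteq> \<Omega> \<and> C2_on (UNIV \<times> \<Omega>) (\<lambda>(x, u). f x u)"
    and A2: "\<exists>C>0. (\<forall>x. \<forall>u\<in>U1. norm (f x u) \<le> C * (1 + norm x)) \<or>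
                   (\<forall>x. \<forall>u\<in>U1. \<bar>x \<bullet> f x u\<bar> \<le> C * (1 + (norm x)\<^sup>2))"
    and A3: "\<And>x. convex (f x ` U1)"
    and A4_smooth: "C2_on UNIV g"
    and A4_manifold: "\<And>i. is_manifold (CARD('n) - 1) {x. g x $ i = 0}"
    and G_interior: "interior (constraint_set g) \<noteq> {}"
    and adm_nonempty: "admissible f g \<noteq> {}"
    and compl_nonempty: "constraint_set g - admissible f g \<noteq> {}"
  shows "(top_of_set (constraint_set g) frontier_of admissible f g) \<inter> constraint_set0 g \<subseteq>
    {z \<in> constraint_set0 g.
       \<exists>u0. is_arg_min (\<lambda>u. MAX i\<in>active g z. lie_deriv f (\<lambda>x. g x $ i) z u) (\<lambda>u. u \<in> U1) u0 \<and>
            (MAX i\<in>active g z. lie_deriv f (\<lambda>x. g x $ i) z u0) \<le> 0}"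
proof
  fix z assume z: "z \<in> (top_of_set (constraint_set g) frontier_of admissible f g) \<inter> constraint_set0 g"
  then have "z \<in> top_of_set (constraint_set g) closure_of admissible f g"
    by (simp add: frontier_of_def)
  then have z_closure: "z \<in> closure (admissible f g)"
    by (metis closure_of_subtopology_subset euclidean_closure_of subsetD)
  have active: "finite (active g z)" "active g z \<noteq> {}"
    using z by (auto simp: constraint_set0_def active_def)
  have cont: "continuous_on (UNIV \<times> U1) (\<lambda>(x, u). f x u)"
  proof -
    obtain \<Omega> where \<Omega>: "U1 \<subseteq> \<Omega>" "C2_on (UNIV \<times> \<Omega>) (\<lambda>(x, u). f x u)"
      using A1 by blast
    then have "continuous_on (UNIV \<times> \<Omega>) (\<lambda>(x, u). f x u)"
      unfolding C2_on_def
      by (meson continuous_at_imp_continuous_on has_derivative_continuous)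
    then show ?thesis
      by (rule continuous_on_subset) (use \<Omega> in auto)
  qed
  have cont_z: "continuous_on U1 (f z)"
    using continuous_on_compose2[OF cont continuous_on_Pair[OF continuous_on_const continuous_on_id]]
    by (auto simp: image_subset_iff)
  obtain Dg where Dg: "(g has_derivative Dg) (at z)"
    using A4_smooth unfolding C2_on_def by blast
  interpret Dg: bounded_linear Dg
    using Dg by (rule has_derivative_bounded_linear)
  have lie: "lie_deriv f (\<lambda>x. g x $ i) z u = Dg (f z u) $ i" for i u
    using frechet_derivative_at[OF bounded_linear.has_derivative[OF bounded_linear_vec_nth Dg], of i]
    by (simp add: lie_deriv_def fun_eq_iff)
  have cont_Dg: "continuous_on U1 (\<lambda>u. Dg (f z u))"
    using cont_z by (rule Dg.continuous_on)
  have "\<exists>u\<in>U1. \<forall>i\<in>active g z. Dg (f z u) $ i \<le> 0"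
  proof (rule ccontr)
    assume no: "\<not> ?thesis"
    define S where "S = Dg ` f z ` U1"
    have "convex S"
      unfolding S_def by (intro convex_linear_image A3 Dg.linear_axioms)
    moreover have "compact S"
      using compact_continuous_image[OF cont_Dg] by (simp add: S_def image_image)
    moreover have "S \<noteq> {}"
      by (simp add: S_def)
    moreover have "\<exists>i\<in>active g z. s $ i > 0" if "s \<in> S" for s
      using no that by (auto simp: S_def not_le)
    ultimately obtain a b where "b > 0" and b: "\<And>s. s \<in> S \<Longrightarrow> b \<le> a \<bullet> s"
      and a: "\<And>i. a $ i \<ge> 0" "\<And>i. i \<notin> active g z \<Longrightarrow> a $ i = 0"
      using nonneg_functional_positive_on_compact[of S "active g z"] by metis
    \<comment> \<open>the gradient at \<open>z\<close> of the weighted constraint \<open>a \<bullet> g\<close>\<close>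
    let ?l = "adjoint Dg a"
    have l: "?l \<bullet> v = a \<bullet> Dg v" for v
      using adjoint_works[OF Dg.linear_axioms, of v a] by (simp add: inner_commute)
    have "((\<lambda>x. a \<bullet> g x) has_derivative (\<lambda>v. ?l \<bullet> v)) (at z)"
      using bounded_linear.has_derivative[OF bounded_linear_inner_right Dg, of a] by (simp add: l)
    moreover have "a \<bullet> g z = 0"
      unfolding inner_vec_def using a(2) by (intro sum.neutral) (auto simp: active_def)
    moreover have "b \<le> ?l \<bullet> f z u" if "u \<in> U1" for u
      using b that by (simp add: l S_def)
    ultimately obtain e where "e > 0" and e:
      "\<And>x0 u x. dist x0 z < e \<Longrightarrow> u \<in> controls \<Longrightarrow> is_solution f u x0 x \<Longrightarrow> \<exists>t\<ge>0. a \<bullet> g (x t) > 0"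
      using solutions_escape[OF cont] \<open>b > 0\<close> by blast
    obtain x0 where "x0 \<in> admissible f g" "dist x0 z < e"
      using z_closure \<open>e > 0\<close> by (meson closure_approachable)
    then obtain u x where "u \<in> controls" "is_solution f u x0 x"
      and viable: "\<And>i t. t \<ge> 0 \<Longrightarrow> g (x t) $ i \<le> 0"
      by (auto simp: admissible_def)
    with e \<open>dist x0 z < e\<close> obtain t where t: "t \<ge> 0" "a \<bullet> g (x t) > 0"
      by meson
    have "a \<bullet> g (x t) \<le> 0"
      unfolding inner_vec_def using a(1) viable[OF t(1)] by (intro sum_nonpos) (simp add: mult_nonneg_nonpos)
    with t show False
      by simp
  qed
  then obtain u where u: "u \<in> U1" "\<forall>i\<in>active g z. Dg (f z u) $ i \<le> 0"
    by blast
  let ?m = "\<lambda>u. MAX i\<in>active g z. lie_deriv f (\<lambda>x. g x $ i) z u"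
  have "continuous_on U1 ?m"
    unfolding lie using active cont_Dg by (intro continuous_on_MAX) (auto intro!: continuous_intros)
  then obtain u0 where u0: "u0 \<in> U1" "\<And>u. u \<in> U1 \<Longrightarrow> ?m u0 \<le> ?m u"
    using continuous_attains_inf[of "U1 :: (real^'m) set" ?m] by auto
  have "?m u \<le> 0"
    using active u by (simp add: lie)
  then have "?m u0 \<le> 0"
    using u0(2)[OF u(1)] by linarith
  moreover have "is_arg_min ?m (\<lambda>u. u \<in> U1) u0"
    using u0 by (auto simp: is_arg_min_def not_less)
  ultimately show "z \<in> {z \<in> constraint_set0 g.
       \<exists>u0. is_arg_min (\<lambda>u. MAX i\<in>active g z. lie_deriv f (\<lambda>x. g x $ i) z u) (\<lambda>u. u \<in> U1) u0 \<and>
            (MAX i\<in>active g z. lie_deriv f (\<lambda>x. g x $ i) z u0) \<le> 0}"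
    using z by blast
qed

end
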